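(* Let $j\in\{2,\dots,J\}$, $i\in\{1,\dots,m_j\}$, and let $\Omega_i^{(j)}=\bigcup_{\ell=1}^{N_i}\Omega_{k_\ell}^{(j-1)}$ in a refinement chain. Suppose that the subsets $\{\Omega_{k_\ell}^{(j-1)}\}_{\ell=1}^{N_i}$ are either disjoint (construction (D)) or with fixed scenarios appearing in all of them (construction (F)). Fix $\bm x\in\mathcal X$. Let $\{\bm e_{k_\ell}^{(j-1)}\}_{\ell=1}^{N_i}$ be a collection of points such that $\bm e_{k_\ell}^{(j-1)}\in\Lambda_{k_\ell}^{(j-1)}$ for all $\ell=1,\dots,N_i$, with corresponding dual objective function values $z_{k_\ell}^{(j-1)}:=\sum_{s:\bm\omega^s\in\Omega_{k_\ell}^{(j-1)}}(\bm h^s-\bm T^s\bm x)^\top(\bm e_{k_\ell}^{(j-1)})^s$. Then $$\bm e_i^{(j)}:=\sum_{\ell=1}^{N_i}\pi_{k_\ell,i}^{(j-1,j)}\bm e_{k_\ell}^{(j-1)}$$ is an extreme point of $\Lambda_i^{(j)}$ if and only if each $\bm e_{k_\ell}^{(j-1)}$ is an extreme point of $\Lambda_{k_\ell}^{(j-1)}$ for all $\ell=1,\dots,N_i$. In this case, the corresponding objective function value $z_i^{(j)}:=\sum_{s:\bm\omega^s\in\Omega_i^{(j)}}(\bm h^s-\bm T^s\bm x)^\top(\bm e_i^{(j)})^s$ satisfies $$z_i^{(j)}=\sum_{\ell=1}^{N_i}\pi_{k_\ell,i}^{(j-1,j)}z_{k_\ell}^{(j-1)}.$$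
   Context: Scenarios $\Omega=\{\bm\omega^1,\dots,\bm\omega^{|\mathcal S|}\}$, $\mathcal S=\{1,\dots,|\mathcal S|\}$, with probability measure $\mathbb P$, $p^s=\mathbb P(\bm\omega^s)>0$; $\mathcal X\subseteq\mathbb R^n$ nonempty closed; $\bm W\in\mathbb R^{p\times m}$, $\bm T^s\in\mathbb R^{p\times n}$, $\bm h^s\in\mathbb R^p$, $\bm q^s\in\mathbb R^m$. Refinement chain. For each level $j=1,\dots,J$ there is a collection $\{\Omega_i^{(j)}\}_{i=1}^{m_j}$ of nonempty subsets of $\Omega$, with $m_J=1$, $\Omega_1^{(J)}=\Omega$, such that (R1) $\Omega=\bigcup_i\Omega_i^{(j)}$ for each $j$; (R2) for $j\ge2$ each $\Omega_i^{(j)}$ is a union $\bigcup_{\ell=1}^{N_i}\Omega_{k_\ell}^{(j-1)}$ of sets of level $j-1$. Each $\Omega_i^{(j)}$ carries a probability measure $\mathbb P_i^{(j)}$ (with $\mathbb P_1^{(J)}=\mathbb P$) such that (P1) $\mathbb P_i^{(j)}$ has support $\Omega_i^{(j)}$; (P2) $\mathbb P=\sum_{i}\pi_i^{(j)}\mathbb P_i^{(j)}$ with intra-level weights $\pi_i^{(j)}\ge0$, $\sum_i\pi_i^{(j)}=1$; (P3) for $j\ge2$, $\mathbb P_i^{(j)}=\sum_{\ell=1}^{N_i}\pi_{k_\ell,i}^{(j-1,j)}\mathbb P_{k_\ell}^{(j-1)}$ with inter-level weights $\pi_{k_\ell,i}^{(j-1,j)}\ge0$, $\sum_\ell\pi_{k_\ell,i}^{(j-1,j)}=1$.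 Write $p^s_{\Omega_i^{(j)}}:=\mathbb P_i^{(j)}(\bm\omega^s)$. Construction (D), disjoint partitions: at each level the subsets are pairwise disjoint, $p^s_{\Omega_i^{(j)}}=p^s/\sum_{k:\bm\omega^k\in\Omega_i^{(j)}}p^k$ for $\bm\omega^s\in\Omega_i^{(j)}$, $\pi_i^{(j)}=\sum_{k:\bm\omega^k\in\Omega_i^{(j)}}p^k$. Construction (F), fixed scenarios: for some $f\ge1$ all subsets contain $F=\{\bm\omega^1,\dots,\bm\omega^f\}$; at each level every non-fixed scenario is in exactly one subset and every subset contains a non-fixed scenario; $p^s_{\Omega_i^{(j)}}=p^s$ for $s\le f$, $p^s_{\Omega_i^{(j)}}=\frac{1-\sum_{k=1}^fp^k}{\sum_{k:\bm\omega^k\in\Omega_i^{(j)}\setminus F}p^k}\,p^s$ for $\bm\omega^s\in\Omega_i^{(j)}\setminus F$, $\pi_i^{(j)}=\frac{\sum_{k:\bm\omega^k\in\Omega_i^{(j)}\setminus F}p^k}{1-\sum_{k=1}^fp^k}$. Dual feasible regions. $\Lambda_i^{(j)}=\prod_{s:\bm\omega^s\in\Omega_i^{(j)}}\{\bm\lambda^s\in\mathbb R^p:\bm W^\top\bm\lambda^s\le p^s_{\Omega_i^{(j)}}\bm q^s\}\subseteq\mathbb R^{p|\Omega_i^{(j)}|}$; $(\bm e)^s\in\mathbb R^p$ denotes the block of $\bm e$ for scenario $s$. When $\Omega_{k_\ell}^{(j-1)}\subseteq\Omega_i^{(j)}$, points of $\Lambda_{k_\ell}^{(j-1)}$ are regarded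 as vectors of $\mathbb R^{p|\Omega_i^{(j)}|}$ by setting to zero all components corresponding to scenarios of $\Omega_i^{(j)}$ not in $\Omega_{k_\ell}^{(j-1)}$.
   Formalization: Under construction (F) the printed "if" direction is false; here e_i is shown to be an extreme point if and only if each e_{k_l} is an extreme point and, in addition, all e_{k_l} have equal blocks on every fixed scenario; construction (D) and the objective identity are as stated. *)

theory Defs
  imports "HOL-Probability.Probability"
begin

text \<open>The scenarios are the elements of a finite type \<^typ>\<open>'s\<close>, i.e. a scenario is
  identified with its index and the full scenario set is \<^term>\<open>UNIV\<close>. A probability measure is a
  \<^typ>\<open>'s pmf\<close>, whose support is \<^const>\<open>set_pmf\<close>.

  \<open>Om j i\<close> and \<open>Pr j i\<close> are the \<open>i\<close>-th subset of level \<open>j\<close> and its measure, for \<open>j \<in> {1..J}\<close> and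
  \<open>i \<in> {1..m j}\<close>; other indices are irrelevant. \<open>ch j i\<close> is the set of indices
  \<open>{k_1, ..., k_{N_i}}\<close> of the level \<open>j - 1\<close> subsets whose union is \<open>Om j i\<close>. \<open>intra j i\<close> and
  \<open>inter j k i\<close> are the intra-level weight of \<open>Om j i\<close> and the inter-level weight of \<open>Om (j - 1) k\<close>
  in \<open>Om j i\<close>.\<close>

locale refinement_chain =
  fixes P :: "'s::finite pmf"
    and J :: nat
    and m :: "nat \<Rightarrow> nat"
    and Om :: "nat \<Rightarrow> nat \<Rightarrow> 's set"
    and ch :: "nat \<Rightarrow> nat \<Rightarrow> nat set"
    and Pr :: "nat \<Rightarrow> nat \<Rightarrow> 's pmf"
    and intra :: "nat \<Rightarrow> nat \<Rightarrow> real"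
    and inter :: "nat \<Rightarrow> nat \<Rightarrow> nat \<Rightarrow> real"
  assumes J_pos: "1 \<le> J"
    and Om_nonempty: "\<And>j i. j \<in> {1..J} \<Longrightarrow> i \<in> {1..m j} \<Longrightarrow> Om j i \<noteq> {}"
    and top: "m J = 1" "Om J 1 = UNIV" "Pr J 1 = P"
    and R1: "\<And>j. j \<in> {1..J} \<Longrightarrow> (\<Union>i\<in>{1..m j}. Om j i) = UNIV"
    and R2: "\<And>j i. j \<in> {2..J} \<Longrightarrow> i \<in> {1..m j} \<Longrightarrow>
               ch j i \<subseteq> {1..m (j - 1)} \<and> Om j i = (\<Union>k\<in>ch j i. Om (j - 1) k)"
    and P1: "\<And>j i. j \<in> {1..J} \<Longrightarrow> i \<in> {1..m j} \<Longrightarrow> set_pmf (Pr j i) = Om j i"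
    and P2: "\<And>j. j \<in> {1..J} \<Longrightarrow>
               (\<forall>i\<in>{1..m j}. 0 \<le> intra j i) \<and> (\<Sum>i\<in>{1..m j}. intra j i) = 1 \<and>
               (\<forall>s. pmf P s = (\<Sum>i\<in>{1..m j}. intra j i * pmf (Pr j i) s))"
    and P3: "\<And>j i. j \<in> {2..J} \<Longrightarrow> i \<in> {1..m j} \<Longrightarrow>
               (\<forall>k\<in>ch j i. 0 \<le> inter j k i) \<and> (\<Sum>k\<in>ch j i. inter j k i) = 1 \<and>
               (\<forall>s. pmf (Pr j i) s = (\<Sum>k\<in>ch j i. inter j k i * pmf (Pr (j - 1) k) s))"

definition disjoint_construction ::
  "'s::finite pmf \<Rightarrow> nat \<Rightarrow> (nat \<Rightarrow> nat) \<Rightarrow> (nat \<Rightarrow> nat \<Rightarrow> 's set) \<Rightarrow> (nat \<Rightarrow> nat \<Rightarrow> 's pmf)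
    \<Rightarrow> (nat \<Rightarrow> nat \<Rightarrow> real) \<Rightarrow> bool" where
  "disjoint_construction P J m Om Pr intra \<longleftrightarrow>
    (\<forall>j\<in>{1..J}.
      disjoint_family_on (Om j) {1..m j} \<and>
      (\<forall>i\<in>{1..m j}.
        (\<forall>s\<in>Om j i. pmf (Pr j i) s = pmf P s / (\<Sum>k\<in>Om j i. pmf P k)) \<and>
        intra j i = (\<Sum>k\<in>Om j i. pmf P k)))"

text \<open>\<open>F\<close> is an arbitrary nonempty set; listing its elements first gives the first \<open>f = card F\<close>
  scenarios.\<close>

definition fixed_construction ::
  "'s::finite pmf \<Rightarrow> nat \<Rightarrow> (nat \<Rightarrow> nat) \<Rightarrow> (nat \<Rightarrow> nat \<Rightarrow> 's set) \<Rightarrow> (nat \<Rightarrow> nat \<Rightarrow> 's pmf)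
    \<Rightarrow> (nat \<Rightarrow> nat \<Rightarrow> real) \<Rightarrow> 's set \<Rightarrow> bool" where
  "fixed_construction P J m Om Pr intra F \<longleftrightarrow>
    F \<noteq> {} \<and>
    (\<forall>j\<in>{1..J}.
      (\<forall>s\<in>- F. \<exists>!i. i \<in> {1..m j} \<and> s \<in> Om j i) \<and>
      (\<forall>i\<in>{1..m j}.
        F \<subseteq> Om j i \<and> Om j i - F \<noteq> {} \<and>
        (\<forall>s\<in>F. pmf (Pr j i) s = pmf P s) \<and>
        (\<forall>s\<in>Om j i - F. pmf (Pr j i) s =
           (1 - (\<Sum>k\<in>F. pmf P k)) / (\<Sum>k\<in>Om j i - F. pmf P k) * pmf P s) \<and>
        intra j i = (\<Sum>k\<in>Om j i - F. pmf P k) / (1 - (\<Sum>k\<in>F. pmf P k))))"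

text \<open>The dual feasible region of a subset \<open>A\<close> of scenarios with measure \<open>Q\<close>. All regions live in the
  common space \<^typ>\<open>real^'p^'s\<close>, block \<open>l $ s\<close> belonging to scenario \<open>s\<close>; blocks of scenarios
  outside \<open>A\<close> are zero, which is the zero-padding used to compare regions of nested subsets.\<close>

definition dual_region ::
  "real^'m^'p \<Rightarrow> ('s::finite \<Rightarrow> real^'m) \<Rightarrow> 's set \<Rightarrow> 's pmf \<Rightarrow> (real^'p^'s) set" where
  "dual_region W q A Q =
    {l. (\<forall>s\<in>A. transpose W *v (l $ s) \<le> pmf Q s *\<^sub>R q s) \<and> (\<forall>s. s \<notin> A \<longrightarrow> l $ s = 0)}"

definition dual_objective ::
  "('s::finite \<Rightarrow> real^'p) \<Rightarrow> ('s \<Rightarrow> real^'n^'p) \<Rightarrow> real^'n \<Rightarrow> 's set \<Rightarrow> real^'p^'s \<Rightarrow> real" where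
  "dual_objective h T x A l = (\<Sum>s\<in>A. (h s - T s *v x) \<bullet> (l $ s))"

end

theory Submission
  imports Defs
begin

text \<open>Every dual region is a product of blocks indexed by the scenarios, so a point is extreme iff
  each of its blocks is. A scenario lying in a single child has its block merely rescaled by a
  positive weight, which preserves extremality. On a fixed scenario all children have the same
  block polyhedron, and a convex combination with positive weights is extreme there iff all
  combined points coincide with one extreme point.\<close>

section \<open>Extreme points under products, scalings and convex combinations\<close>

lemma extreme_point_of_vec_prod_iff:
  fixes e :: "'a::real_vector^'s::finite"
  shows "e extreme_point_of {l. \<forall>s. l $ s \<in> C s} \<longleftrightarrow> (\<forall>s. (e $ s) extreme_point_of C s)"
    (is "_ extreme_point_of ?S \<longleftrightarrow> _")
proof
  assume L: "e extreme_point_of ?S"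
  then have e: "e $ t \<in> C t" for t by (simp add: extreme_point_of_def)
  show "\<forall>s. (e $ s) extreme_point_of C s"
    unfolding extreme_point_of_def
  proof (intro allI conjI ballI notI)
    fix s a b
    assume a: "a \<in> C s" and b: "b \<in> C s" and seg: "e $ s \<in> open_segment a b"
    \<comment> \<open>\<open>?up a\<close> alters \<open>e\<close> in block \<open>s\<close> only,
      so a segment through the block \<open>e $ s\<close> lifts to a segment through
      \<open>e\<close> with the same parameter.\<close>
    let ?up = "\<lambda>a. (\<chi> t. if t = s then a else e $ t)"
    obtain u where u: "a \<noteq> b" "0 < u" "u < 1" "e $ s = (1 - u) *\<^sub>R a + u *\<^sub>R b"
      using seg by (auto simp: in_segment)
    have "?up a \<in> ?S" "?up b \<in> ?S" using a b e by auto
    moreover have "e = (1 - u) *\<^sub>R ?up a + u *\<^sub>R ?up b"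
      using u by (auto simp: vec_eq_iff algebra_simps)
    moreover have "?up a \<noteq> ?up b" using u(1) by (auto simp: vec_eq_iff)
    ultimately show False using L u(2,3) unfolding extreme_point_of_def in_segment by blast
  qed (rule e)
next
  assume R: "\<forall>s. (e $ s) extreme_point_of C s"
  show "e extreme_point_of ?S"
    unfolding extreme_point_of_def
  proof (intro conjI ballI notI)
    show "e \<in> ?S" using R by (simp add: extreme_point_of_def)
  next
    fix a b assume ab: "a \<in> ?S" "b \<in> ?S" and seg: "e \<in> open_segment a b"
    obtain u where u: "a \<noteq> b" "0 < u" "u < 1" "e = (1 - u) *\<^sub>R a + u *\<^sub>R b"
      using seg by (auto simp: in_segment)
    \<comment> \<open>Distinct endpoints may agree in many blocks; a block where they differ is
      needed for the projected segment to be nondegenerate.\<close>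
    obtain s where "a $ s \<noteq> b $ s" using u(1) by (auto simp: vec_eq_iff)
    then have "e $ s \<in> open_segment (a $ s) (b $ s)" using u by (auto simp: in_segment)
    then show False using R ab by (auto simp: extreme_point_of_def)
  qed
qed

text \<open>Multiplication by a nonzero scalar is a linear bijection, so it preserves and reflects
  open segments, parameter included.\<close>

lemma extreme_point_of_scaleR_image_iff:
  fixes x :: "'a::real_vector"
  assumes "c \<noteq> 0"
  shows "(c *\<^sub>R x) extreme_point_of ((*\<^sub>R) c ` S) \<longleftrightarrow> x extreme_point_of S"
proof -
  have "c *\<^sub>R x \<in> open_segment (c *\<^sub>R a) (c *\<^sub>R b) \<longleftrightarrow> x \<in> open_segment a b" for a b
  proof -
    have "c *\<^sub>R x = (1 - u) *\<^sub>R c *\<^sub>R a + u *\<^sub>R c *\<^sub>R b \<longleftrightarrow> x = (1 - u) *\<^sub>R a + u *\<^sub>R b" for u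
    proof -
      have "(1 - u) *\<^sub>R c *\<^sub>R a + u *\<^sub>R c *\<^sub>R b = c *\<^sub>R ((1 - u) *\<^sub>R a + u *\<^sub>R b)"
        by (simp add: scaleR_add_right mult.commute)
      then show ?thesis using assms by (metis scaleR_left_imp_eq)
    qed
    then show ?thesis using assms by (simp add: in_segment)
  qed
  then show ?thesis using assms by (auto simp: extreme_point_of_def)
qed

text \<open>Split off the term of \<open>k\<close>: the combination lies strictly between
  \<open>y k\<close> and the normalised average \<open>w\<close> of the other points, which is in
  \<open>S\<close> by convexity. Extremality therefore forces \<open>y k = w\<close>, and then the
  combination is \<open>y k\<close> itself.\<close>

lemma extreme_point_of_convex_sum_imp_eq:
  fixes y :: "'k \<Rightarrow> 'a::real_vector"
  assumes ext: "(\<Sum>k\<in>K. u k *\<^sub>R y k) extreme_point_of S" (is "?x extreme_point_of S")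
    and S: "convex S" and fin: "finite K" and yS: "\<And>k. k \<in> K \<Longrightarrow> y k \<in> S"
    and u: "\<And>k. k \<in> K \<Longrightarrow> 0 < u k" "sum u K = 1" and k: "k \<in> K"
  shows "y k = (\<Sum>k\<in>K. u k *\<^sub>R y k)"
proof (cases "K = {k}")
  case True
  then show ?thesis using u(2) by simp
next
  case False
  let ?K = "K - {k}" and ?v = "1 - u k"
  have v: "sum u ?K = ?v" using fin k u(2) by (simp add: sum_diff1)
  \<comment> \<open>Some other index carries positive weight, so \<open>1 - u k\<close> is positive
    and can serve both as the normalising divisor and as the segment parameter.\<close>
  have "0 < sum u ?K" using False k fin u(1) by (intro sum_pos) auto
  with v have pos: "0 < ?v" by simp
  define w where "w = (\<Sum>l\<in>?K. (u l / ?v) *\<^sub>R y l)"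
  have "w \<in> S"
    unfolding w_def
  proof (rule convex_sum[OF _ S])
    show "(\<Sum>l\<in>?K. u l / ?v) = 1" using v pos by (simp flip: sum_divide_distrib)
  qed (use fin yS u(1) pos in \<open>auto intro: less_imp_le\<close>)
  have "?v *\<^sub>R w = (\<Sum>l\<in>?K. u l *\<^sub>R y l)"
    using pos by (simp add: w_def scaleR_right.sum)
  then have x: "?x = (1 - ?v) *\<^sub>R y k + ?v *\<^sub>R w"
    using fin k by (simp add: sum.remove)
  have "y k = w"
  proof (rule ccontr)
    assume "y k \<noteq> w"
    then have "?x \<in> open_segment (y k) w"
      using x pos u(1)[OF k] unfolding in_segment by (intro conjI exI[of _ ?v]) auto
    then show False using ext \<open>w \<in> S\<close> yS[OF k] by (auto simp: extreme_point_of_def)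
  qed
  then show ?thesis using x by (simp flip: scaleR_add_left)
qed

section \<open>The polyhedron of a single scenario block\<close>

definition dual_block :: "real^'m^'p \<Rightarrow> real^'m \<Rightarrow> (real^'p) set" where
  "dual_block W r = {v. transpose W *v v \<le> r}"

lemma convex_dual_block: "convex (dual_block W r)"
proof (rule convexI)
  fix a b and u v :: real
  assume a: "a \<in> dual_block W r" and b: "b \<in> dual_block W r"
    and uv: "0 \<le> u" "0 \<le> v" "u + v = 1"
  show "u *\<^sub>R a + v *\<^sub>R b \<in> dual_block W r"
    using a b convex_bound_le[OF _ _ uv]
    by (simp add: dual_block_def less_eq_vec_def matrix_vector_right_distrib
        matrix_vector_mult_scaleR del: transpose_matrix_vector)
qed

text \<open>The defining inequalities are homogeneous in the pair of point and right-hand side, so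
  division by a positive \<open>c\<close> preserves them. Thus changing the probability of a
  scenario by a positive factor only rescales its polyhedron.\<close>

lemma dual_block_scaleR:
  assumes "0 < c"
  shows "dual_block W (c *\<^sub>R r) = (*\<^sub>R) c ` dual_block W r"
proof (intro equalityI subsetI)
  fix v assume v: "v \<in> dual_block W (c *\<^sub>R r)"
  have "inverse c *\<^sub>R v \<in> dual_block W r"
    using v assms
    by (simp add: dual_block_def less_eq_vec_def matrix_vector_mult_scaleR field_simps
        del: transpose_matrix_vector)
  then show "v \<in> (*\<^sub>R) c ` dual_block W r"
    using assms by (intro image_eqI[of _ _ "inverse c *\<^sub>R v"]) auto
qed (use assms in \<open>auto simp: dual_block_def less_eq_vec_def matrix_vector_mult_scaleR
      simp del: transpose_matrix_vector\<close>)

text \<open>Reading the zero padding as a factor \<open>{0}\<close> makes the region a product over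
  all scenarios. The only point of that factor is extreme, so padding never obstructs
  extremality.\<close>

lemma dual_region_eq_prod:
  "dual_region W q A Q =
    {l. \<forall>s. l $ s \<in> (if s \<in> A then dual_block W (pmf Q s *\<^sub>R q s) else {0})}"
  by (auto simp: dual_region_def dual_block_def split: if_splits)

lemma extreme_point_of_dual_region_iff:
  "e extreme_point_of dual_region W q A Q \<longleftrightarrow>
    (\<forall>s\<in>A. (e $ s) extreme_point_of dual_block W (pmf Q s *\<^sub>R q s)) \<and> (\<forall>s. s \<notin> A \<longrightarrow> e $ s = 0)"
  unfolding dual_region_eq_prod extreme_point_of_vec_prod_iff
  by (auto simp: extreme_point_of_def split: if_splits)

section \<open>Combining child regions into a parent region\<close>

text \<open>Serves both constructions, with \<open>F\<close> empty for disjoint partitions.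
  Agreement on \<open>F\<close> has to appear in the equivalence: different points of the common
  polyhedron average with positive weights to a point that is not extreme.\<close>

lemma extreme_point_of_dual_region_combination_iff:
  fixes Q :: "'s::finite pmf" and R :: "'k \<Rightarrow> 's pmf" and e :: "'k \<Rightarrow> real^'p^'s"
  assumes fin: "finite K"
    and Q: "set_pmf Q = (\<Union>k\<in>K. B k)" and R: "\<And>k. k \<in> K \<Longrightarrow> set_pmf (R k) = B k"
    and F: "\<And>k. k \<in> K \<Longrightarrow> F \<subseteq> B k" "\<And>k s. k \<in> K \<Longrightarrow> s \<in> F \<Longrightarrow> pmf (R k) s = pmf Q s"
    and nonfixed: "\<And>k. k \<in> K \<Longrightarrow> B k - F \<noteq> {}"
    and disj: "\<And>k l s. k \<in> K \<Longrightarrow> l \<in> K \<Longrightarrow> s \<in> B k \<Longrightarrow> s \<in> B l \<Longrightarrow> s \<notin> F \<Longrightarrow> k = l"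
    and u: "\<And>k. k \<in> K \<Longrightarrow> 0 \<le> u k" "sum u K = 1"
    and mix: "\<And>s. pmf Q s = (\<Sum>k\<in>K. u k * pmf (R k) s)"
    and e: "\<And>k. k \<in> K \<Longrightarrow> e k \<in> dual_region W q (B k) (R k)"
  shows "(\<Sum>k\<in>K. u k *\<^sub>R e k) extreme_point_of dual_region W q (\<Union>k\<in>K. B k) Q \<longleftrightarrow>
    (\<forall>k\<in>K. e k extreme_point_of dual_region W q (B k) (R k)) \<and>
    (\<forall>s\<in>F. \<forall>k\<in>K. \<forall>l\<in>K. e k $ s = e l $ s)"
    (is "?e extreme_point_of _ \<longleftrightarrow> _")
proof -
  have zero: "e k $ s = 0" if "k \<in> K" "s \<notin> B k" for k s
    using e that by (auto simp: dual_region_def)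
  have block: "e k $ s \<in> dual_block W (pmf (R k) s *\<^sub>R q s)" if "k \<in> K" "s \<in> B k" for k s
    using e that by (auto simp: dual_region_def dual_block_def)
  have nth: "?e $ s = (\<Sum>k\<in>K. u k *\<^sub>R (e k $ s))" for s by simp
  \<comment> \<open>Off \<open>F\<close> every other child omits \<open>s\<close>, so both sums
    collapse to the term of \<open>k\<close>: the points vanish there by padding, the probabilities
    by the support condition.\<close>
  have single: "?e $ s = u k *\<^sub>R (e k $ s)" "pmf Q s = u k * pmf (R k) s"
    if "k \<in> K" "s \<in> B k" "s \<notin> F" for k s
  proof -
    have other: "s \<notin> B l" if "l \<in> K - {k}" for l using that disj \<open>k \<in> K\<close> \<open>s \<in> B k\<close> \<open>s \<notin> F\<close> by blast
    have "(\<Sum>l\<in>K. u l *\<^sub>R (e l $ s)) = (\<Sum>l\<in>{k}. u l *\<^sub>R (e l $ s))"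
      using fin that other zero by (intro sum.mono_neutral_right) auto
    then show "?e $ s = u k *\<^sub>R (e k $ s)" using nth by simp
    have "(\<Sum>l\<in>K. u l * pmf (R l) s) = (\<Sum>l\<in>{k}. u l * pmf (R l) s)"
      using fin that other R by (intro sum.mono_neutral_right) (auto simp: pmf_eq_0_set_pmf)
    then show "pmf Q s = u k * pmf (R k) s" using mix by simp
  qed
  \<comment> \<open>Strict positivity comes from a nonfixed scenario of \<open>B k\<close>: it has
    positive mass under \<open>Q\<close>, and all of that mass is
    \<open>u k * pmf (R k) s\<close>.\<close>
  have upos: "0 < u k" if k: "k \<in> K" for k
  proof -
    obtain s where s: "s \<in> B k" "s \<notin> F" using nonfixed[OF k] by blast
    have "s \<in> set_pmf Q" using Q k s by blast
    then have "u k \<noteq> 0" using single(2)[OF k s] by (auto simp: set_pmf_iff)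
    then show ?thesis using u(1)[OF k] by simp
  qed
  \<comment> \<open>The same factor \<open>u k\<close> relates the two blocks and the two right-hand
    sides.\<close>
  have scaled: "(?e $ s) extreme_point_of dual_block W (pmf Q s *\<^sub>R q s) \<longleftrightarrow>
      (e k $ s) extreme_point_of dual_block W (pmf (R k) s *\<^sub>R q s)"
    if "k \<in> K" "s \<in> B k" "s \<notin> F" for k s
  proof -
    have "dual_block W (pmf Q s *\<^sub>R q s) = (*\<^sub>R) (u k) ` dual_block W (pmf (R k) s *\<^sub>R q s)"
      using dual_block_scaleR[OF upos[OF that(1)]] single(2)[OF that] by (metis scaleR_scaleR)
    moreover have "u k \<noteq> 0" using upos[OF that(1)] by simp
    ultimately show ?thesis
      unfolding single(1)[OF that] by (simp only: extreme_point_of_scaleR_image_iff not_False_eq_True)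
  qed
  have agree: "?e $ s = e k $ s" if "k \<in> K" "\<forall>k\<in>K. \<forall>l\<in>K. e k $ s = e l $ s" for k s
  proof -
    have "?e $ s = (\<Sum>l\<in>K. u l *\<^sub>R (e k $ s))"
      unfolding nth using that by (intro sum.cong refl arg_cong[of _ _ "(*\<^sub>R) _"]) blast
    also have "\<dots> = e k $ s"
      unfolding scaleR_left.sum[symmetric] u(2) by (rule scaleR_one)
    finally show ?thesis .
  qed
  have fixed: "(\<forall>k\<in>K. e k $ s = ?e $ s)"
    if "s \<in> F" and ext: "(?e $ s) extreme_point_of dual_block W (pmf Q s *\<^sub>R q s)" for s
  proof
    fix k assume k: "k \<in> K"
    \<comment> \<open>On \<open>F\<close> the children and the parent give \<open>s\<close> the same
      probability, so all child blocks lie in the parent's polyhedron and form a genuine convex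
      combination there.\<close>
    have mem: "e l $ s \<in> dual_block W (pmf Q s *\<^sub>R q s)" if "l \<in> K" for l
      using block[OF that] F that \<open>s \<in> F\<close> by (metis subsetD)
    show "e k $ s = ?e $ s"
      unfolding nth
      by (rule extreme_point_of_convex_sum_imp_eq[OF ext[unfolded nth] convex_dual_block fin mem
            upos u(2) k])
  qed
  show ?thesis (is "?L \<longleftrightarrow> ?R")
  proof
    assume ?L
    then have ext: "(?e $ s) extreme_point_of dual_block W (pmf Q s *\<^sub>R q s)"
      if "k \<in> K" "s \<in> B k" for k s
      using that by (auto simp only: extreme_point_of_dual_region_iff)
    have eq: "e k $ s = ?e $ s" if "k \<in> K" "s \<in> F" for k s
      using that fixed[OF that(2) ext[OF that(1)]] F(1) by blast
    have "(e k $ s) extreme_point_of dual_block W (pmf (R k) s *\<^sub>R q s)"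
      if "k \<in> K" "s \<in> B k" for k s
      \<comment> \<open>On \<open>F\<close> both the block and the right-hand side coincide with
        those of the parent; off \<open>F\<close> the rescaling transfers extremality.\<close>
      using ext[OF that] scaled[OF that] eq[OF that(1)] F(2)[OF that(1)] by (cases "s \<in> F") auto
    then have "\<forall>k\<in>K. e k extreme_point_of dual_region W q (B k) (R k)"
      using zero by (auto simp only: extreme_point_of_dual_region_iff)
    moreover have "\<forall>s\<in>F. \<forall>k\<in>K. \<forall>l\<in>K. e k $ s = e l $ s"
      using eq by (intro ballI) (rule trans[OF _ sym])
    ultimately show ?R by (rule conjI)
  next
    assume R': ?R
    then have ext: "(e k $ s) extreme_point_of dual_block W (pmf (R k) s *\<^sub>R q s)"
      if "k \<in> K" "s \<in> B k" for k s
      using that by (auto simp only: extreme_point_of_dual_region_iff)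
    have "(?e $ s) extreme_point_of dual_block W (pmf Q s *\<^sub>R q s)"
      if "k \<in> K" "s \<in> B k" for k s
    proof (cases "s \<in> F")
      case True
      then show ?thesis
        using ext[OF that] agree[OF that(1), of s] F(2)[OF that(1) True] R' by metis
    next
      case False
      then show ?thesis using ext[OF that] scaled[OF that] by blast
    qed
    \<comment> \<open>Outside the union every child block is padding.\<close>
    moreover have "?e $ s = 0" if "s \<notin> (\<Union>k\<in>K. B k)" for s
      unfolding nth using that zero by (intro sum.neutral) auto
    ultimately show ?L by (auto simp only: extreme_point_of_dual_region_iff)
  qed
qed

text \<open>Padding lets each child's sum be extended to the whole union by zero terms; over this
  common scenario set the objective is linear in the dual point.\<close>

lemma dual_objective_combination:
  fixes e :: "'k \<Rightarrow> real^'p^'s::finite"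
  assumes e: "\<And>k. k \<in> K \<Longrightarrow> e k \<in> dual_region W q (B k) (R k)"
  shows "dual_objective h T x (\<Union>k\<in>K. B k) (\<Sum>k\<in>K. u k *\<^sub>R e k) =
    (\<Sum>k\<in>K. u k * dual_objective h T x (B k) (e k))"
proof -
  let ?A = "\<Union>k\<in>K. B k"
  have "dual_objective h T x ?A (e k) = dual_objective h T x (B k) (e k)" if "k \<in> K" for k
    unfolding dual_objective_def
    using that e by (intro sum.mono_neutral_right) (auto simp: dual_region_def)
  moreover have "dual_objective h T x ?A (\<Sum>k\<in>K. u k *\<^sub>R e k) =
      (\<Sum>k\<in>K. u k * dual_objective h T x ?A (e k))"
    unfolding dual_objective_def
    by (simp add: inner_sum_right sum_distrib_left) (rule sum.swap)
  ultimately show ?thesis by simp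
qed

section \<open>Application to one refinement step of the chain\<close>

theorem proposition3p4:
  fixes P :: "'s::finite pmf"
    and X :: "(real^'n) set" and x :: "real^'n"
    and W :: "real^'m^'p"
    and T :: "'s \<Rightarrow> real^'n^'p" and h :: "'s \<Rightarrow> real^'p" and q :: "'s \<Rightarrow> real^'m"
    and J :: nat and m :: "nat \<Rightarrow> nat"
    and Om :: "nat \<Rightarrow> nat \<Rightarrow> 's set" and ch :: "nat \<Rightarrow> nat \<Rightarrow> nat set"
    and Pr :: "nat \<Rightarrow> nat \<Rightarrow> 's pmf"
    and intra :: "nat \<Rightarrow> nat \<Rightarrow> real" and inter :: "nat \<Rightarrow> nat \<Rightarrow> nat \<Rightarrow> real"
    and j i :: nat
    and e :: "nat \<Rightarrow> real^'p^'s" and e' :: "real^'p^'s"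
    and z :: "nat \<Rightarrow> real" and z' :: real
  assumes "\<forall>s. pmf P s > 0"
    and "X \<noteq> {}" and "closed X" and "x \<in> X"
    and "refinement_chain P J m Om ch Pr intra inter"
    and "disjoint_construction P J m Om Pr intra \<or>
         (\<exists>F. fixed_construction P J m Om Pr intra F)"
    and "j \<in> {2..J}" and "i \<in> {1..m j}"
    and "\<forall>k\<in>ch j i. e k \<in> dual_region W q (Om (j - 1) k) (Pr (j - 1) k)"
    and "\<forall>k\<in>ch j i. z k = dual_objective h T x (Om (j - 1) k) (e k)"
    and "e' = (\<Sum>k\<in>ch j i. inter j k i *\<^sub>R e k)"
    and "z' = dual_objective h T x (Om j i) e'"
  shows
    "(disjoint_construction P J m Om Pr intra \<longrightarrow>
        (e' extreme_point_of dual_region W q (Om j i) (Pr j i) \<longleftrightarrow>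
          (\<forall>k\<in>ch j i. e k extreme_point_of dual_region W q (Om (j - 1) k) (Pr (j - 1) k)))) \<and>
     (\<forall>F. fixed_construction P J m Om Pr intra F \<longrightarrow>
        (e' extreme_point_of dual_region W q (Om j i) (Pr j i) \<longleftrightarrow>
          (\<forall>k\<in>ch j i. e k extreme_point_of dual_region W q (Om (j - 1) k) (Pr (j - 1) k)) \<and>
          (\<forall>s\<in>F. \<forall>k\<in>ch j i. \<forall>l\<in>ch j i. e k $ s = e l $ s))) \<and>
     ((\<forall>k\<in>ch j i. e k extreme_point_of dual_region W q (Om (j - 1) k) (Pr (j - 1) k)) \<longrightarrow>
        z' = (\<Sum>k\<in>ch j i. inter j k i * z k))"
proof -
  interpret refinement_chain P J m Om ch Pr intra inter by fact
  \<comment> \<open>Since \<open>2 \<le> j\<close>, the natural number \<open>j - 1\<close> is a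
    true predecessor and a level of the chain.\<close>
  have j: "j - 1 \<in> {1..J}" "j \<in> {1..J}" using assms(7) by auto
  note R2' = R2[OF assms(7,8)] and P3' = P3[OF assms(7,8)]
  have ch: "k \<in> {1..m (j - 1)}" if "k \<in> ch j i" for k using R2' that by blast
  have fin: "finite (ch j i)" using R2' finite_subset by blast
  have A: "Om j i = (\<Union>k\<in>ch j i. Om (j - 1) k)" using R2' by blast
  have Q: "set_pmf (Pr j i) = (\<Union>k\<in>ch j i. Om (j - 1) k)"
    using P1[OF j(2) assms(8)] A by simp
  \<comment> \<open>\<open>F\<close> stays free, so that each construction only has to supply its
    four premises on overlap and probabilities; supports and weights come from the chain
    axioms.\<close>
  have comb: "e' extreme_point_of dual_region W q (Om j i) (Pr j i) \<longleftrightarrow>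
      (\<forall>k\<in>ch j i. e k extreme_point_of dual_region W q (Om (j - 1) k) (Pr (j - 1) k)) \<and>
      (\<forall>s\<in>F. \<forall>k\<in>ch j i. \<forall>l\<in>ch j i. e k $ s = e l $ s)"
    if "\<And>k. k \<in> ch j i \<Longrightarrow> F \<subseteq> Om (j - 1) k"
      "\<And>k s. k \<in> ch j i \<Longrightarrow> s \<in> F \<Longrightarrow> pmf (Pr (j - 1) k) s = pmf (Pr j i) s"
      "\<And>k. k \<in> ch j i \<Longrightarrow> Om (j - 1) k - F \<noteq> {}"
      "\<And>k l s. k \<in> ch j i \<Longrightarrow> l \<in> ch j i \<Longrightarrow> s \<in> Om (j - 1) k \<Longrightarrow> s \<in> Om (j - 1) l \<Longrightarrow>
        s \<notin> F \<Longrightarrow> k = l" for F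
    unfolding assms(11) A
  proof (rule extreme_point_of_dual_region_combination_iff)
    show "set_pmf (Pr (j - 1) k) = Om (j - 1) k" if "k \<in> ch j i" for k
      by (rule P1[OF j(1) ch[OF that]])
    show "e k \<in> dual_region W q (Om (j - 1) k) (Pr (j - 1) k)" if "k \<in> ch j i" for k
      using assms(9) that by (rule bspec)
    show "0 \<le> inter j k i" if "k \<in> ch j i" for k using P3' that by (elim conjE) (rule bspec)
    show "(\<Sum>k\<in>ch j i. inter j k i) = 1" using P3' by (elim conjE)
    show "pmf (Pr j i) s = (\<Sum>k\<in>ch j i. inter j k i * pmf (Pr (j - 1) k) s)" for s
      using P3' by (elim conjE) (rule spec)
  qed (fact fin Q that)+
  have "e' extreme_point_of dual_region W q (Om j i) (Pr j i) \<longleftrightarrow>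
      (\<forall>k\<in>ch j i. e k extreme_point_of dual_region W q (Om (j - 1) k) (Pr (j - 1) k))"
    if D: "disjoint_construction P J m Om Pr intra"
  proof -
    have "disjoint_family_on (Om (j - 1)) {1..m (j - 1)}"
      using D j(1) by (auto simp: disjoint_construction_def)
    then have "k = l" if "k \<in> ch j i" "l \<in> ch j i" "s \<in> Om (j - 1) k" "s \<in> Om (j - 1) l" for k l s
      using that ch by (auto dest!: disjoint_family_onD)
    \<comment> \<open>With \<open>F\<close> empty the agreement condition is vacuous, and
      nonemptiness of the subsets provides the nonfixed scenario required of each child.\<close>
    then show ?thesis using comb[of "{}"] Om_nonempty[OF j(1) ch] by simp
  qed
  moreover have "e' extreme_point_of dual_region W q (Om j i) (Pr j i) \<longleftrightarrow>
      (\<forall>k\<in>ch j i. e k extreme_point_of dual_region W q (Om (j - 1) k) (Pr (j - 1) k)) \<and>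
      (\<forall>s\<in>F. \<forall>k\<in>ch j i. \<forall>l\<in>ch j i. e k $ s = e l $ s)"
    if "fixed_construction P J m Om Pr intra F" for F
  proof (rule comb)
    note Fx = that[unfolded fixed_construction_def, THEN conjunct2, rule_format]
    note F1 = Fx[OF j(1)] and F2 = Fx[OF j(2)]
    fix k assume k: "k \<in> ch j i"
    show "F \<subseteq> Om (j - 1) k" "Om (j - 1) k - F \<noteq> {}" using F1 ch[OF k] by blast+
    \<comment> \<open>At both levels a fixed scenario keeps its original probability
      \<open>pmf P s\<close>.\<close>
    show "pmf (Pr (j - 1) k) s = pmf (Pr j i) s" if "s \<in> F" for s
      using F1 F2 ch[OF k] assms(8) that by metis
    \<comment> \<open>At level \<open>j - 1\<close> a nonfixed scenario belongs to exactly one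
      subset.\<close>
    show "k = l" if "l \<in> ch j i" "s \<in> Om (j - 1) k" "s \<in> Om (j - 1) l" "s \<notin> F" for l s
      using F1 ch[OF k] ch[OF that(1)] that by blast
  qed
  moreover have "z' = (\<Sum>k\<in>ch j i. inter j k i * z k)"
    using dual_objective_combination[of "ch j i" e W q "Om (j - 1)" "Pr (j - 1)"] assms(9-12) A
    by simp
  ultimately show ?thesis by blast
qed

end
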